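(* Assume that $\lim_{m\to\infty}\alpha_m^{\mathbf a}=\alpha$ in the vague topology and $\lim_{m\to\infty}\min\mathbf a_m=\mathfrak a$ for some nonzero subprobability measure $\alpha$ on $\mathbb R$ and some $\mathfrak a\in\mathbb R\cup\{\infty\}$. Fix $n\in\mathbb Z_{>0}$ and assume that $\mathfrak a+\min\mathbf b_n>0$. Let $\epsilon>0$ and let $$A=\int_{\mathbb R}\frac{\alpha(\mathrm da)}{a+\min\mathbf b_n}.$$ Then, $\mathbf P$-almost surely, there exists a random $T\in\mathbb Z_{>0}$ such that $$\Big|\mathrm H^{\mathbf a,\mathbf b}(n,t)-\frac tA\Big|\le\epsilon t\quad\text{and}\quad\Big|\sigma^{\mathbf a,\mathbf b}(n,t)-\frac tA+n\Big|\le\epsilon t\qquad\text{for all } t\ge T.$$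
   Context: $[n]=\{1,\dots,n\}$; $\mathrm{Exp}(\lambda)$ is the exponential distribution with rate $\lambda$ (mean $1/\lambda$). Fix two collections of real parameters $\mathbf a=\{\mathbf a_m(i):m\in\mathbb Z_{>0},i\in[m]\}$ and $\mathbf b=\{\mathbf b_n(j):n\in\mathbb Z_{>0},j\in[n]\}$ such that $\mathbf a_m(i)+\mathbf b_n(j)>0$ for all $m,n\in\mathbb Z_{>0}$, $i\in[m]$, $j\in[n]$. Write $\min\mathbf a_m=\min_{i\in[m]}\mathbf a_m(i)$ and $\min\mathbf b_n=\min_{j\in[n]}\mathbf b_n(j)$. Let $\alpha_m^{\mathbf a}=\frac1m\sum_{i=1}^m\delta_{\mathbf a_m(i)}$. Vague convergence $\mu_n\to\mu$ of finite Borel measures on $\mathbb R$ means $\int f\,\mathrm d\mu_n\to\int f\,\mathrm d\mu$ for every continuous $f:\mathbb R\to\mathbb R$ vanishing at infinity. A subprobability measure is a nonnegative Borel measure of total mass at most $1$. Let $(\Omega,\mathbf P)$ be $\Omega=\mathbb R^{\mathbb Z_{>0}^2}$ with the product measure under which the coordinates are i.i.d. $\mathrm{Exp}(1)$. For each $m,n\in\mathbb Z_{>0}$ let $\{\omega_{m,n}^{\mathbf a,\mathbf b}(i,j): i\in[m],j\in[n]\}$ be independent random variables on $(\Omega,\mathbf P)$ with $\omega_{m,n}^{\mathbf a,\mathbf b}(i,j)\sim\mathrm{Exp}(\mathbf a_m(i)+\mathbf b_n(j))$; no assumption is made about the joint distribution of these collections for different $(m,n)$. The last-passage time is $\mathrm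 G^{\mathbf a,\mathbf b}(m,n)=\max_{\pi}\sum_{(i,j)\in\pi}\omega^{\mathbf a,\mathbf b}_{m,n}(i,j)$, the maximum over all up-right lattice paths $\pi$ from $(1,1)$ to $(m,n)$ (steps $(1,0)$ or $(0,1)$). For $n\in\mathbb Z_{>0}$ and $t\ge0$ (with $\sup\emptyset=-\infty$), $$\mathrm H^{\mathbf a,\mathbf b}(n,t)=\max\{\sup\{m\in\mathbb Z_{>0}:\mathrm G^{\mathbf a,\mathbf b}(m,n)\le t\},0\},\qquad \sigma^{\mathbf a,\mathbf b}(n,t)=\mathrm H^{\mathbf a,\mathbf b}(n,t)-n+1.$$ *)

theory Defs
  imports "HOL-Probability.Probability"
begin

text \<open>Vague convergence of finite Borel measures on the real line, tested against the continuous
  functions vanishing at infinity (not only the compactly supported ones).\<close>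

definition vague_conv :: "(nat \<Rightarrow> real measure) \<Rightarrow> real measure \<Rightarrow> bool" where
  "vague_conv \<mu> \<nu> \<longleftrightarrow>
     (\<forall>f :: real \<Rightarrow> real. continuous_on UNIV f \<and> (f \<longlongrightarrow> 0) at_infinity \<longrightarrow>
        (\<lambda>m. integral\<^sup>L (\<mu> m) f) \<longlonglongrightarrow> integral\<^sup>L \<nu> f)"

text \<open>\<open>empirical x m\<close> is $\frac1m \sum_{i=1}^m \delta_{x(i)}$; \<open>return borel y\<close> is the Dirac mass at \<open>y\<close>.
  See \<open>emeasure_empirical\<close> for the fact that the set function is really a measure.\<close>

definition empirical :: "(nat \<Rightarrow> real) \<Rightarrow> nat \<Rightarrow> real measure" where
  "empirical x m =
     measure_of UNIV (sets borel) (\<lambda>S. (\<Sum>i=1..m. emeasure (return borel (x i)) S) / of_nat m)"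

lemma sets_empirical [simp, measurable_cong]: "sets (empirical x m) = sets borel"
  unfolding empirical_def by (metis sets.sets_measure_of_eq space_borel)

lemma space_empirical [simp]: "space (empirical x m) = UNIV"
  using sets_eq_imp_space_eq[OF sets_empirical] by simp

lemma emeasure_empirical:
  assumes "S \<in> sets borel"
  shows "emeasure (empirical x m) S = (\<Sum>i=1..m. emeasure (return borel (x i)) S) / of_nat m"
proof (rule emeasure_measure_of[OF empirical_def])
  let ?\<mu> = "\<lambda>S. (\<Sum>i=1..m. emeasure (return borel (x i)) S) / (of_nat m :: ennreal)"
  show "sets borel \<subseteq> Pow (UNIV :: real set)" by simp
  show "S \<in> sets (empirical x m)" using assms by simp
  show "positive (sets (empirical x m)) ?\<mu>" by (simp add: positive_def)
  show "countably_additive (sets (empirical x m)) ?\<mu>"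
  proof (rule countably_additiveI)
    fix F :: "nat \<Rightarrow> real set"
    assume F: "range F \<subseteq> sets (empirical x m)" "disjoint_family F"
    have "(\<Sum>k. ?\<mu> (F k)) = (\<Sum>k. \<Sum>i=1..m. emeasure (return borel (x i)) (F k)) / of_nat m"
      by (simp add: ennreal_suminf_divide)
    also have "(\<Sum>k. \<Sum>i=1..m. emeasure (return borel (x i)) (F k)) =
        (\<Sum>i=1..m. \<Sum>k. emeasure (return borel (x i)) (F k))"
      by (rule suminf_sum) simp
    also have "\<dots> = (\<Sum>i=1..m. emeasure (return borel (x i)) (\<Union>k. F k))"
      using F by (intro sum.cong refl suminf_emeasure) auto
    finally show "(\<Sum>k. ?\<mu> (F k)) = ?\<mu> (\<Union>k. F k)" .
  qed
qed

definition exp_space :: "(nat \<times> nat \<Rightarrow> real) measure" where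
  "exp_space = PiM ({1..} \<times> {1..}) (\<lambda>_. density lborel (exponential_density 1))"

lemma prob_space_exp_space: "prob_space exp_space"
  unfolding exp_space_def by (intro prob_space_PiM prob_space_exponential_density) simp

definition up_right_path :: "nat \<Rightarrow> nat \<Rightarrow> (nat \<times> nat) list \<Rightarrow> bool" where
  "up_right_path m n p \<longleftrightarrow> p \<noteq> [] \<and> hd p = (1, 1) \<and> last p = (m, n) \<and>
     successively (\<lambda>u v. v = (fst u + 1, snd u) \<or> v = (fst u, snd u + 1)) p"

lemma up_right_steps:
  assumes "successively (\<lambda>u v. v = (fst u + 1, snd u) \<or> v = (fst u, snd u + 1)) p" "p \<noteq> []"
  shows "fst (last p) + snd (last p) + 1 = fst (hd p) + snd (hd p) + length p
    \<and> (\<forall>u\<in>set p. fst u \<le> fst (last p) \<and> snd u \<le> snd (last p))"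
  using assms
proof (induction p)
  case (Cons u p)
  then show ?case
    by (cases p) auto
qed simp

lemma finite_up_right_paths: "finite {p. up_right_path m n p}"
proof (rule finite_subset)
  show "{p. up_right_path m n p} \<subseteq> {p. set p \<subseteq> {..m} \<times> {..n} \<and> length p \<le> m + n}"
  proof clarsimp
    fix p assume "up_right_path m n p"
    with up_right_steps[of p] show "set p \<subseteq> {..m} \<times> {..n} \<and> length p \<le> m + n"
      by (auto simp: up_right_path_def)
  qed
  show "finite {p. set p \<subseteq> {..m} \<times> {..n} \<and> length p \<le> m + n}"
    by (intro finite_lists_length_le) simp
qed

definition last_passage :: "(nat \<Rightarrow> nat \<Rightarrow> real) \<Rightarrow> nat \<Rightarrow> nat \<Rightarrow> real" where
  "last_passage W m n = Max ((\<lambda>p. \<Sum>(i, j)\<leftarrow>p. W i j) ` {p. up_right_path m n p})"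

text \<open>Below, \<open>w m n i j\<close> are the weights used for the endpoint \<open>(m, n)\<close>: different endpoints
  have their own families of weights. The height and the shifted height \<open>lpp_flux\<close>, usually written $\sigma$,
  take extended real values, as the supremum may be $-\infty$ (empty set) or $+\infty$.\<close>

definition lpp_height :: "(nat \<Rightarrow> nat \<Rightarrow> nat \<Rightarrow> nat \<Rightarrow> real) \<Rightarrow> nat \<Rightarrow> real \<Rightarrow> ereal" where
  "lpp_height w n t = max (Sup {ereal (real m) | m. 1 \<le> m \<and> last_passage (w m n) m n \<le> t}) 0"

definition lpp_flux :: "(nat \<Rightarrow> nat \<Rightarrow> nat \<Rightarrow> nat \<Rightarrow> real) \<Rightarrow> nat \<Rightarrow> real \<Rightarrow> ereal" where
  "lpp_flux w n t = lpp_height w n t - ereal (real n) + 1"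

end

theory Submission
  imports Defs "HOL-Real_Asymp.Real_Asymp"
begin

text \<open>Let $\beta = \min \mathbf b_n$, attained at the row \<open>k\<close>. For fixed \<open>n\<close> an up-right path to
  $(m, n)$ consists of one cell per column and at most \<open>n - 1\<close> further cells. A cell in column \<open>i\<close>
  has rate at least $\mathbf a_m(i) + \beta$, with equality in the row \<open>k\<close>. So no path has mean much above
  $\sum_{i \le m} \frac{1}{\mathbf a_m(i) + \beta}$, and a path that runs along the row \<open>k\<close> reaches it. By
  vague convergence this sum is asymptotic to $m A$, and the theorem says that the passage time
  satisfies $\mathrm G(m, n) \sim m A$ almost surely, read backwards.

  The weights for different \<open>m\<close> are coupled arbitrarily, so almost sure convergence has to come from
  summable tail bounds and the Borel-Cantelli lemma (\<open>AE_last_passage_linear\<close>). The Chernoff bound for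
  sums of exponential variables (\<open>chernoff_exponential_sum\<close>) has an exponent built from the resolvent sum
  $\sum_{i \le m} \frac{1}{\mathbf a_m(i) + \beta \mp s}$. Since $\mathfrak a + \beta > 0$, the rates are
  eventually bounded away from \<open>0\<close>, so the resolvent sums converge after division by \<open>m\<close>
  (\<open>tendsto_empirical_resolvent\<close>) and their limits tend to \<open>A\<close> as \<open>s\<close> tends to \<open>0\<close>
  (\<open>resolvent_integral_shift\<close>). Hence each path has exponentially small tails in \<open>m\<close>, while the number of
  paths is at most \<open>m ^ n\<close> (\<open>card_up_right_paths_le\<close>). The upper tail takes a union bound over the paths,
  the lower tail the single path along the row \<open>k\<close>.

  Passing from \<open>G\<close> to the height and the flux is deterministic (\<open>lpp_height_flux_close\<close>), and the time \<open>T\<close>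
  depends on the randomness only through the first index from which on the linear bounds hold, which
  makes it measurable.\<close>

section \<open>Up-right paths\<close>

lemma up_right_path_induct [consumes 1, case_names start right up]:
  assumes "up_right_path m n p"
    and "P 1 1 [(1, 1)]"
    and "\<And>m n p. up_right_path m n p \<Longrightarrow> P m n p \<Longrightarrow> P (Suc m) n (p @ [(Suc m, n)])"
    and "\<And>m n p. up_right_path m n p \<Longrightarrow> P m n p \<Longrightarrow> P m (Suc n) (p @ [(m, Suc n)])"
  shows "P m n p"
  using assms(1)
proof (induction p arbitrary: m n rule: rev_induct)
  case Nil
  then show ?case by (simp add: up_right_path_def)
next
  case (snoc c p)
  show ?case
  proof (cases "p = []")
    case True
    then show ?thesis
      using snoc.prems assms(2) by (auto simp: up_right_path_def)
  next
    case False
    obtain m' n' where last: "last p = (m', n')" by fastforce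
    have c: "c = (m, n)" and p: "up_right_path m' n' p"
      and step: "(m = Suc m' \<and> n = n') \<or> (m = m' \<and> n = Suc n')"
      using snoc.prems False last by (auto simp: up_right_path_def successively_append_iff)
    show ?thesis
      using step assms(3,4)[OF p snoc.IH[OF p]] c by auto
  qed
qed

lemma up_right_path_start: "up_right_path 1 1 [(1, 1)]"
  by (simp add: up_right_path_def)

lemma up_right_path_right: "up_right_path m n p \<Longrightarrow> up_right_path (Suc m) n (p @ [(Suc m, n)])"
  by (auto simp: up_right_path_def successively_append_iff)

lemma up_right_path_up: "up_right_path m n p \<Longrightarrow> up_right_path m (Suc n) (p @ [(m, Suc n)])"
  by (auto simp: up_right_path_def successively_append_iff)

lemma up_right_path_subset: "up_right_path m n p \<Longrightarrow> set p \<subseteq> {1..m} \<times> {1..n} \<and> 1 \<le> m \<and> 1 \<le> n"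
  by (induction rule: up_right_path_induct) auto

lemma up_right_path_distinct: "up_right_path m n p \<Longrightarrow> distinct p"
  by (induction rule: up_right_path_induct) (use up_right_path_subset in fastforce)+

text \<open>A path occupies every column at least once, and at most \<open>n - 1\<close> of its cells are repeated
  visits to a column. This is why, for fixed \<open>n\<close>, the passage time is governed by a single sum over
  the columns.\<close>

lemma up_right_path_column_sum_le:
  fixes g :: "nat \<Rightarrow> real"
  assumes "up_right_path m n p" and "\<And>i. i \<in> {1..m} \<Longrightarrow> g i \<le> K"
  shows "(\<Sum>(i, j)\<leftarrow>p. g i) \<le> (\<Sum>i=1..m. g i) + real (n - 1) * K"
  using assms
proof (induction rule: up_right_path_induct)
  case start
  then show ?case by simp
next
  case (right m n p)
  then show ?case by simp
next
  case (up m n p)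
  then have "g m \<le> K" "1 \<le> n" using up_right_path_subset[OF up.hyps(1)] by auto
  with up show ?case by (auto simp: of_nat_diff algebra_simps)
qed

text \<open>Pascal's recursion for the last step of a path bounds the number of paths by a polynomial
  in \<open>m\<close>; any polynomial bound is enough to survive the union bound against exponentially small
  tails.\<close>

lemma card_up_right_paths_le: "card {p. up_right_path m n p} \<le> m ^ n"
proof (induction "m + n" arbitrary: m n rule: less_induct)
  case less
  consider "m = 0 \<or> n = 0" | "m = 1" "n = 1" | m' n' where "m = Suc m'" "n = Suc n'" "m' \<noteq> 0 \<or> n' \<noteq> 0"
    by (cases m; cases n) auto
  then show ?case
  proof cases
    case 1
    then have "{p. up_right_path m n p} = {}"
      using up_right_path_subset by force
    then show ?thesis by (simp only: card.empty)
  next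
    case 2
    have "p = [(1, 1)]" if "up_right_path 1 1 p" for p
      using that
      by (induction "1::nat" "1::nat" p rule: up_right_path_induct)
        (auto dest: up_right_path_subset)
    then have "{p. up_right_path m n p} \<subseteq> {[(1, 1)]}" using 2 by auto
    then have "card {p. up_right_path m n p} \<le> card {[(1::nat, 1::nat)]}"
      by (rule card_mono[rotated]) simp
    then show ?thesis using 2 by simp
  next
    case 3
    have "{p. up_right_path m n p} \<subseteq>
        (\<lambda>p. p @ [(m, n)]) ` {p. up_right_path m' n p} \<union> (\<lambda>p. p @ [(m, n)]) ` {p. up_right_path m n' p}"
    proof
      fix p assume "p \<in> {p. up_right_path m n p}"
      then have "up_right_path m n p" by simp
      then have "(m = 1 \<and> n = 1) \<or>
          (\<exists>q m'. m = Suc m' \<and> p = q @ [(m, n)] \<and> up_right_path m' n q) \<or>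
          (\<exists>q n'. n = Suc n' \<and> p = q @ [(m, n)] \<and> up_right_path m n' q)"
        by (induction rule: up_right_path_induct) auto
      then show "p \<in> (\<lambda>p. p @ [(m, n)]) ` {p. up_right_path m' n p} \<union>
          (\<lambda>p. p @ [(m, n)]) ` {p. up_right_path m n' p}"
        using 3 by auto
    qed
    then have "card {p. up_right_path m n p} \<le> card ((\<lambda>p. p @ [(m, n)]) ` {p. up_right_path m' n p} \<union>
        (\<lambda>p. p @ [(m, n)]) ` {p. up_right_path m n' p})"
      by (rule card_mono[rotated]) (simp add: finite_up_right_paths)
    also have "\<dots> \<le> card {p. up_right_path m' n p} + card {p. up_right_path m n' p}"
      by (rule order.trans[OF card_Un_le])
        (intro add_mono card_image_le finite_up_right_paths)
    also have "\<dots> \<le> m' ^ n + m ^ n'"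
      by (intro add_mono less) (use 3 in auto)
    also have "\<dots> \<le> m' * m ^ n' + m ^ n'"
      using 3 by (auto intro!: mult_left_mono power_mono)
    also have "\<dots> = m ^ n" using 3 by simp
    finally show ?thesis .
  qed
qed

lemma up_right_path_through_row:
  assumes "1 \<le> m" "k \<in> {1..n}"
  shows "\<exists>p. up_right_path m n p \<and> {1..m} \<times> {k} \<subseteq> set p"
proof -
  have "\<exists>p. up_right_path 1 k p \<and> (1, k) \<in> set p" if "1 \<le> k" for k
    using that
  proof (induction k rule: dec_induct)
    case base
    then show ?case using up_right_path_start by force
  next
    case (step k)
    then show ?case using up_right_path_up by fastforce
  qed
  then have "\<exists>p. up_right_path 1 k p \<and> {1..1} \<times> {k} \<subseteq> set p" using assms by fastforce
  with \<open>1 \<le> m\<close> have row: "\<exists>p. up_right_path m k p \<and> {1..m} \<times> {k} \<subseteq> set p"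
  proof (induction m rule: dec_induct)
    case base
    then show ?case by simp
  next
    case (step m)
    then obtain p where "up_right_path m k p" "{1..m} \<times> {k} \<subseteq> set p" by auto
    then have "up_right_path (Suc m) k (p @ [(Suc m, k)])" "{1..Suc m} \<times> {k} \<subseteq> set (p @ [(Suc m, k)])"
      using up_right_path_right by (auto simp: atLeastAtMostSuc_conv)
    then show ?case by blast
  qed
  have "k \<le> n" using assms by simp
  then show ?thesis
  proof (induction n rule: dec_induct)
    case base
    show ?case by (rule row)
  next
    case (step n)
    then obtain p where "up_right_path m n p" "{1..m} \<times> {k} \<subseteq> set p" by auto
    then have "up_right_path m (Suc n) (p @ [(m, Suc n)])" "{1..m} \<times> {k} \<subseteq> set (p @ [(m, Suc n)])"
      using up_right_path_up by auto
    then show ?case by blast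
  qed
qed

section \<open>Exponential moments\<close>

lemma nn_integral_exp_exponential:
  assumes "distributed M lborel X (exponential_density l)" and "s < l" "0 < l"
  shows "(\<integral>\<^sup>+x. ennreal (exp (s * X x)) \<partial>M) = ennreal (l / (l - s))"
proof -
  have "(\<integral>\<^sup>+x. ennreal (exp (s * X x)) \<partial>M) =
      (\<integral>\<^sup>+y. ennreal (exponential_density l y) * ennreal (exp (s * y)) \<partial>lborel)"
    by (rule distributed_nn_integral[OF assms(1), symmetric]) simp
  also have "\<dots> = (\<integral>\<^sup>+y. ennreal (l / (l - s)) * ennreal (exponential_density (l - s) y) \<partial>lborel)"
  proof (intro nn_integral_cong)
    fix y :: real
    have "exp (- y * l) * exp (s * y) = exp (- y * (l - s))"
      by (simp add: exp_add[symmetric] algebra_simps)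
    then have "l * exp (- y * l) * exp (s * y) = l / (l - s) * ((l - s) * exp (- y * (l - s)))"
      using assms by simp
    then show "ennreal (exponential_density l y) * ennreal (exp (s * y)) =
        ennreal (l / (l - s)) * ennreal (exponential_density (l - s) y)"
      using assms by (auto simp: exponential_density_def ennreal_mult[symmetric])
  qed
  also have "\<dots> = ennreal (l / (l - s)) * emeasure (density lborel (exponential_density (l - s))) UNIV"
    by (simp add: nn_integral_cmult emeasure_density)
  also have "emeasure (density lborel (exponential_density (l - s))) UNIV = 1"
    using prob_space.emeasure_space_1[OF prob_space_exponential_density[of "l - s"]] assms by simp
  finally show ?thesis by simp
qed

text \<open>The elementary bound $\mathbf E e^{sX} = 1 + \frac{s}{l-s} \le \exp(\frac{s}{l-s})$ holds for
  both signs of \<open>s\<close>, so one Chernoff estimate serves for the upper tail (\<open>s > 0\<close>) and for the lower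
  tail (\<open>s < 0\<close>) of a sum of independent exponential variables.\<close>

lemma (in prob_space) chernoff_exponential_sum:
  assumes "finite I" "indep_vars (\<lambda>_. borel) X I"
    and distr: "\<And>i. i \<in> I \<Longrightarrow> distributed M lborel (X i) (exponential_density (l i))"
    and rate: "\<And>i. i \<in> I \<Longrightarrow> s < l i \<and> 0 < l i"
  shows "prob {x \<in> space M. s * u \<le> s * (\<Sum>i\<in>I. X i x)} \<le> exp (- s * u + (\<Sum>i\<in>I. s / (l i - s)))"
proof -
  have [measurable]: "X i \<in> borel_measurable M" if "i \<in> I" for i
    using distributed_measurable[OF distr[OF that]] by simp
  have indep: "indep_vars (\<lambda>_. borel) (\<lambda>i x. ennreal (exp (s * X i x))) I"
    by (rule indep_vars_compose2[OF assms(2)]) simp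
  have "emeasure M {x \<in> space M. s * u \<le> s * (\<Sum>i\<in>I. X i x)} =
      emeasure M {x \<in> space M. 1 \<le> ennreal (exp (- s * u)) * ennreal (exp (s * (\<Sum>i\<in>I. X i x)))}"
    by (intro arg_cong[where f = "emeasure M"] Collect_cong)
      (simp add: ennreal_mult[symmetric] exp_add[symmetric])
  also have "\<dots> \<le> ennreal (exp (- s * u)) *
      (\<integral>\<^sup>+x. ennreal (exp (s * (\<Sum>i\<in>I. X i x))) * indicator (space M) x \<partial>M)"
    by (rule nn_integral_Markov_inequality) auto
  also have "(\<integral>\<^sup>+x. ennreal (exp (s * (\<Sum>i\<in>I. X i x))) * indicator (space M) x \<partial>M) =
      (\<integral>\<^sup>+x. (\<Prod>i\<in>I. ennreal (exp (s * X i x))) \<partial>M)"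
    by (intro nn_integral_cong) (simp add: sum_distrib_left exp_sum \<open>finite I\<close> prod_ennreal)
  also have "\<dots> = (\<Prod>i\<in>I. \<integral>\<^sup>+x. ennreal (exp (s * X i x)) \<partial>M)"
    by (rule indep_vars_nn_integral[OF \<open>finite I\<close> indep]) simp
  also have "\<dots> = (\<Prod>i\<in>I. ennreal (l i / (l i - s)))"
    using nn_integral_exp_exponential[OF distr] rate by (intro prod.cong) auto
  also have "\<dots> = ennreal (\<Prod>i\<in>I. l i / (l i - s))"
    using rate by (intro prod_ennreal) (simp add: less_imp_le)
  also have "\<dots> \<le> ennreal (\<Prod>i\<in>I. exp (s / (l i - s)))"
  proof (intro ennreal_leI prod_mono conjI)
    fix i assume "i \<in> I"
    then show "0 \<le> l i / (l i - s)" using rate by (simp add: less_imp_le)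
    have "l i / (l i - s) = 1 + s / (l i - s)" using rate[OF \<open>i \<in> I\<close>] by (simp add: field_simps)
    also have "\<dots> \<le> exp (s / (l i - s))" by (rule exp_ge_add_one_self)
    finally show "l i / (l i - s) \<le> exp (s / (l i - s))" .
  qed
  finally have "emeasure M {x \<in> space M. s * u \<le> s * (\<Sum>i\<in>I. X i x)} \<le>
      ennreal (exp (- s * u)) * ennreal (\<Prod>i\<in>I. exp (s / (l i - s)))"
    by (simp add: mult_left_mono)
  also have "\<dots> = ennreal (exp (- s * u + (\<Sum>i\<in>I. s / (l i - s))))"
    unfolding exp_add exp_sum[OF \<open>finite I\<close>] by (simp add: ennreal_mult')
  finally show ?thesis
    by (simp add: emeasure_eq_measure)
qed

section \<open>Resolvent sums of the empirical measures\<close>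

lemma integral_empirical:
  assumes "1 \<le> m" and [measurable]: "f \<in> borel_measurable borel"
  shows "integral\<^sup>L (empirical x m) f = (\<Sum>i=1..m. f (x i)) / real m"
proof -
  have x[measurable]: "x \<in> uniform_count_measure {1..m} \<rightarrow>\<^sub>M borel" by simp
  have "empirical x m = distr (uniform_count_measure {1..m}) borel x"
  proof (rule measure_eqI)
    fix S assume "S \<in> sets (empirical x m)"
    then have S[measurable]: "S \<in> sets borel" by simp
    have "emeasure (empirical x m) S = (\<Sum>i=1..m. indicator S (x i)) / of_nat m"
      using S by (simp add: emeasure_empirical)
    also have "(\<Sum>i=1..m. indicator S (x i) :: ennreal) = of_nat (card (x -` S \<inter> {1..m}))"
    proof -
      have "(\<Sum>i=1..m. indicator S (x i) :: ennreal) = (\<Sum>i\<in>x -` S \<inter> {1..m}. 1)"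
        by (intro sum.mono_neutral_cong_right) (auto simp: indicator_def split: if_splits)
      then show ?thesis by simp
    qed
    also have "of_nat (card (x -` S \<inter> {1..m})) / of_nat m =
        emeasure (distr (uniform_count_measure {1..m}) borel x) S"
    proof -
      have "emeasure (distr (uniform_count_measure {1..m}) borel x) S =
          emeasure (uniform_count_measure {1..m}) (x -` S \<inter> {1..m})"
        by (subst emeasure_distr[OF x S]) (simp add: space_uniform_count_measure)
      also have "\<dots> = ennreal (real (card (x -` S \<inter> {1..m})) / real m)"
        by (subst emeasure_uniform_count_measure) auto
      finally show ?thesis
        using assms(1) by (simp add: ennreal_of_nat_eq_real_of_nat divide_ennreal)
    qed
    finally show "emeasure (empirical x m) S = emeasure (distr (uniform_count_measure {1..m}) borel x) S" .
  qed simp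
  then show ?thesis
    using integral_distr[OF x assms(2)] by (simp add: integral_uniform_count_measure)
qed

text \<open>A lower bound on the atoms survives the limit: testing against a function that vanishes at
  infinity and is positive exactly on \<open>{..<d}\<close> shows that the limit has no mass there.\<close>

lemma AE_vague_limit_ge:
  assumes "sets \<alpha> = sets borel" "finite_measure \<alpha>"
    and conv: "vague_conv (\<lambda>m. empirical (x m) m) \<alpha>"
    and ge: "\<forall>\<^sub>F m in sequentially. \<forall>i\<in>{1..m}. d \<le> x m i"
  shows "AE y in \<alpha>. d \<le> y"
proof -
  interpret finite_measure \<alpha> by fact
  note [measurable_cong] = \<open>sets \<alpha> = sets borel\<close>
  define f :: "real \<Rightarrow> real" where "f y = max 0 (d - y) / (1 + (d - y)\<^sup>2)" for y
  have pos: "1 + (d - y)\<^sup>2 > 0" for y :: real by (simp add: add_pos_nonneg)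
  have cont: "continuous_on UNIV f"
    unfolding f_def using pos by (intro continuous_intros ballI) (simp add: less_imp_neq[symmetric])
  then have [measurable]: "f \<in> borel_measurable borel"
    by (rule borel_measurable_continuous_onI)
  have bounds: "0 \<le> f y" "f y \<le> 1" for y
  proof -
    show "0 \<le> f y" unfolding f_def by simp
    have "d - y \<le> 1 + (d - y)\<^sup>2"
      using sum_squares_bound[of "d - y" 1] by (smt (verit) one_power2 mult_cancel_left1 zero_le_power2)
    then show "f y \<le> 1" unfolding f_def using pos[of y] by simp
  qed
  have "(f \<longlongrightarrow> 0) at_infinity"
  proof (rule Lim_null_comparison)
    show "\<forall>\<^sub>F y in at_infinity. norm (f y) \<le> 1 / \<bar>d - y\<bar>"
    proof (rule eventuallyI)
      fix y
      have "\<bar>d - y\<bar> * \<bar>d - y\<bar> \<le> 1 + (d - y)\<^sup>2" by (simp add: power2_eq_square)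
      then have "\<bar>d - y\<bar> / (1 + (d - y)\<^sup>2) \<le> 1 / \<bar>d - y\<bar>"
        using pos[of y] by (cases "d = y") (simp_all add: field_simps)
      moreover have "norm (f y) \<le> \<bar>d - y\<bar> / (1 + (d - y)\<^sup>2)"
        unfolding f_def using pos[of y] by (auto simp: abs_div intro!: divide_right_mono)
      ultimately show "norm (f y) \<le> 1 / \<bar>d - y\<bar>" by linarith
    qed
    show "((\<lambda>y. 1 / \<bar>d - y\<bar>) \<longlongrightarrow> 0) at_infinity"
      unfolding at_infinity_eq_at_top_bot
      by (rule filterlim_sup; real_asymp)
  qed
  with conv cont have "(\<lambda>m. integral\<^sup>L (empirical (x m) m) f) \<longlonglongrightarrow> integral\<^sup>L \<alpha> f"
    by (simp add: vague_conv_def)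
  moreover have "\<forall>\<^sub>F m in sequentially. integral\<^sup>L (empirical (x m) m) f = 0"
    using ge eventually_ge_at_top[of 1]
  proof eventually_elim
    case (elim m)
    then show ?case by (auto simp: integral_empirical f_def max_absorb1)
  qed
  then have "(\<lambda>m. integral\<^sup>L (empirical (x m) m) f) \<longlonglongrightarrow> 0"
    by (rule tendsto_eventually)
  ultimately have "integral\<^sup>L \<alpha> f = 0" using LIMSEQ_unique by blast
  moreover have "integrable \<alpha> f"
    by (rule integrable_const_bound[of _ 1]) (use bounds in auto)
  ultimately have "AE y in \<alpha>. f y = 0"
    using integral_nonneg_eq_0_iff_AE[of \<alpha> f] bounds by simp
  then show ?thesis
  proof eventually_elim
    case (elim y)
    then show ?case using pos[of y] by (auto simp: f_def max_def split: if_splits)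
  qed
qed

text \<open>\<open>1 / (a + c)\<close> does not vanish at $-\infty$, but only its values on \<open>{d..}\<close> matter;
  reflecting it at \<open>d\<close> turns it into an admissible test function.\<close>

lemma tendsto_empirical_resolvent:
  assumes "sets \<alpha> = sets borel" "finite_measure \<alpha>"
    and conv: "vague_conv (\<lambda>m. empirical (x m) m) \<alpha>"
    and ge: "\<forall>\<^sub>F m in sequentially. \<forall>i\<in>{1..m}. d \<le> x m i"
    and c: "d + c > 0"
  shows "(\<lambda>m. (\<Sum>i=1..m. 1 / (x m i + c)) / real m) \<longlonglongrightarrow> (\<integral>y. 1 / (y + c) \<partial>\<alpha>)"
proof -
  note [measurable_cong] = \<open>sets \<alpha> = sets borel\<close>
  define f :: "real \<Rightarrow> real" where "f y = 1 / (\<bar>y - d\<bar> + (d + c))" for y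
  have f_eq: "f y = 1 / (y + c)" if "d \<le> y" for y using that by (simp add: f_def)
  have cont: "continuous_on UNIV f"
    unfolding f_def using c by (intro continuous_intros ballI) (smt (verit) abs_ge_zero)
  have [measurable]: "f \<in> borel_measurable borel"
    using cont by (rule borel_measurable_continuous_onI)
  have "(f \<longlongrightarrow> 0) at_infinity"
    unfolding at_infinity_eq_at_top_bot f_def
    by (rule filterlim_sup; real_asymp)
  with conv cont have "(\<lambda>m. integral\<^sup>L (empirical (x m) m) f) \<longlonglongrightarrow> integral\<^sup>L \<alpha> f"
    by (simp add: vague_conv_def)
  also have "integral\<^sup>L \<alpha> f = (\<integral>y. 1 / (y + c) \<partial>\<alpha>)"
    using AE_vague_limit_ge[OF assms(1-4)] by (intro integral_cong_AE) (auto simp: f_eq)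
  finally show ?thesis
  proof (rule Lim_transform_eventually)
    show "\<forall>\<^sub>F m in sequentially. integral\<^sup>L (empirical (x m) m) f = (\<Sum>i=1..m. 1 / (x m i + c)) / real m"
      using ge eventually_ge_at_top[of 1]
      by eventually_elim (auto simp: integral_empirical f_eq intro!: sum.cong arg_cong2[where f = "(/)"])
  qed
qed

lemma integrable_resolvent:
  fixes c d :: real
  assumes "sets \<alpha> = sets borel" "finite_measure \<alpha>" "AE y in \<alpha>. d \<le> y" "d + c > 0"
  shows "integrable \<alpha> (\<lambda>y. 1 / (y + c))"
proof -
  interpret finite_measure \<alpha> by fact
  note [measurable_cong] = \<open>sets \<alpha> = sets borel\<close>
  show ?thesis
  proof (rule integrable_const_bound[of _ "1 / (d + c)"])
    show "AE y in \<alpha>. norm (1 / (y + c)) \<le> 1 / (d + c)"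
      using assms(3) by eventually_elim (use assms(4) in \<open>auto intro!: divide_left_mono\<close>)
  qed simp
qed

lemma resolvent_integral_pos:
  fixes c d :: real
  assumes "sets \<alpha> = sets borel" "finite_measure \<alpha>" "emeasure \<alpha> UNIV \<noteq> 0"
    and "AE y in \<alpha>. d \<le> y" "d + c > 0"
  shows "0 < (\<integral>y. 1 / (y + c) \<partial>\<alpha>)"
proof (rule ccontr)
  interpret finite_measure \<alpha> by fact
  have nonneg: "AE y in \<alpha>. 0 \<le> 1 / (y + c)"
    using assms(4) by eventually_elim (use assms(5) in auto)
  assume "\<not> 0 < (\<integral>y. 1 / (y + c) \<partial>\<alpha>)"
  then have "(\<integral>y. 1 / (y + c) \<partial>\<alpha>) = 0"
    using integral_nonneg_AE[OF nonneg] by simp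
  then have "AE y in \<alpha>. 1 / (y + c) = 0"
    using integral_nonneg_eq_0_iff_AE[OF integrable_resolvent[OF assms(1,2,4,5)] nonneg] by simp
  with assms(4) have "AE y in \<alpha>. False"
    by eventually_elim (use assms(5) in auto)
  then show False using assms(3) sets_eq_imp_space_eq[OF assms(1)]
    by (simp add: AE_iff_measurable[OF sets.top])
qed

text \<open>The Chernoff exponents involve the resolvent at a point shifted by \<open>s\<close>. Since
  $|\frac1{y+c-s} - \frac1{y+c}| \le \frac{2|s|}{(d+c)^2}$ on \<open>{d..}\<close> when
  $|s| \le \frac{d+c}2$, a small shift costs little in the limit.\<close>

lemma resolvent_integral_shift:
  fixes c d s :: real
  assumes "sets \<alpha> = sets borel" "subprob_space \<alpha>" "AE y in \<alpha>. d \<le> y"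
    and "d + c > 0" "\<bar>s\<bar> \<le> (d + c) / 2"
  shows "\<bar>(\<integral>y. 1 / (y + (c - s)) \<partial>\<alpha>) - (\<integral>y. 1 / (y + c) \<partial>\<alpha>)\<bar> \<le> 2 * \<bar>s\<bar> / (d + c)\<^sup>2"
proof -
  interpret subprob_space \<alpha> by fact
  note [measurable_cong] = \<open>sets \<alpha> = sets borel\<close>
  have fin: "finite_measure \<alpha>" by (rule finite_measure_axioms)
  have int: "integrable \<alpha> (\<lambda>y. 1 / (y + (c - s)))" "integrable \<alpha> (\<lambda>y. 1 / (y + c))"
    using assms by (auto intro!: integrable_resolvent[OF assms(1) fin assms(3)])
  have "AE y in \<alpha>. norm (1 / (y + (c - s)) - 1 / (y + c)) \<le> 2 * \<bar>s\<bar> / (d + c)\<^sup>2"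
    using assms(3)
  proof eventually_elim
    case (elim y)
    have le: "(d + c) / 2 \<le> y + (c - s)" "d + c \<le> y + c" using elim assms(5) by (auto simp: abs_le_iff field_simps)
    then have pos: "0 < y + (c - s)" "0 < y + c" using assms(4) by auto
    have "1 / (y + (c - s)) - 1 / (y + c) = s / ((y + (c - s)) * (y + c))"
      using pos by (simp add: field_simps)
    then have "norm (1 / (y + (c - s)) - 1 / (y + c)) = \<bar>s\<bar> / ((y + (c - s)) * (y + c))"
      using pos by (simp add: abs_mult)
    also have "\<dots> \<le> \<bar>s\<bar> / ((d + c) / 2 * (d + c))"
      using le pos assms(4) by (intro divide_left_mono mult_mono) auto
    finally show ?case by (simp add: power2_eq_square field_simps)
  qed
  then have "(\<integral>y. norm (1 / (y + (c - s)) - 1 / (y + c)) \<partial>\<alpha>) \<le> (\<integral>y. 2 * \<bar>s\<bar> / (d + c)\<^sup>2 \<partial>\<alpha>)"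
    using int by (intro integral_mono_AE integrable_norm Bochner_Integration.integrable_diff) auto
  then have "norm (\<integral>y. 1 / (y + (c - s)) - 1 / (y + c) \<partial>\<alpha>) \<le> 2 * \<bar>s\<bar> / (d + c)\<^sup>2 * measure \<alpha> (space \<alpha>)"
    by (intro order.trans[OF integral_norm_bound]) (simp add: mult_ac)
  also have "\<dots> \<le> 2 * \<bar>s\<bar> / (d + c)\<^sup>2 * 1"
    by (intro mult_left_mono subprob_measure_le_1) simp
  finally show ?thesis using int by (simp add: Bochner_Integration.integral_diff)
qed

text \<open>This fixes the Chernoff parameter \<open>s\<close>: small enough that the shift moves neither sum across
  the margin \<open>\<delta> m\<close> around $m \int \frac{\alpha(\mathrm dy)}{y+c}$.\<close>

lemma eventually_shifted_resolvent_sums: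
  assumes "sets \<alpha> = sets borel" "subprob_space \<alpha>"
    and conv: "vague_conv (\<lambda>m. empirical (x m) m) \<alpha>"
    and ge: "\<forall>\<^sub>F m in sequentially. \<forall>i\<in>{1..m}. d \<le> x m i"
    and c: "d + c > 0" and "0 < \<delta>"
  obtains s where "0 < s" "s \<le> (d + c) / 2"
    and "\<forall>\<^sub>F m in sequentially. (\<Sum>i=1..m. 1 / (x m i + c - s)) \<le> m * ((\<integral>y. 1 / (y + c) \<partial>\<alpha>) + \<delta>)"
    and "\<forall>\<^sub>F m in sequentially. m * ((\<integral>y. 1 / (y + c) \<partial>\<alpha>) - \<delta>) \<le> (\<Sum>i=1..m. 1 / (x m i + c + s))"
proof -
  interpret subprob_space \<alpha> by fact
  have fin: "finite_measure \<alpha>" by (rule finite_measure_axioms)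
  have supp: "AE y in \<alpha>. d \<le> y" by (rule AE_vague_limit_ge[OF assms(1) fin conv ge])
  let ?I = "\<lambda>c. \<integral>y. 1 / (y + c) \<partial>\<alpha>"
  define s where "s = min ((d + c) / 2) (\<delta> * (d + c)\<^sup>2 / 4)"
  have s: "0 < s" "s \<le> (d + c) / 2" "s \<le> \<delta> * (d + c)\<^sup>2 / 4"
    using c \<open>0 < \<delta>\<close> unfolding s_def
    by (simp_all only: min_less_iff_conj min.cobounded1 min.cobounded2) simp
  have "2 * s / (d + c)\<^sup>2 \<le> \<delta> / 2"
    using s(3) c by (simp add: field_simps)
  then have I: "?I (c - s) < ?I c + \<delta>" "?I c - \<delta> < ?I (c + s)"
    using resolvent_integral_shift[OF assms(1,2) supp c, of s]
      resolvent_integral_shift[OF assms(1,2) supp c, of "- s"] s \<open>0 < \<delta>\<close> by auto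
  have "\<forall>\<^sub>F m in sequentially. (\<Sum>i=1..m. 1 / (x m i + (c - s))) / m < ?I c + \<delta>"
    using tendsto_empirical_resolvent[OF assms(1) fin conv ge, of "c - s"] I(1) s c
    by (intro order_tendstoD) auto
  then have 1: "\<forall>\<^sub>F m in sequentially. (\<Sum>i=1..m. 1 / (x m i + c - s)) \<le> m * (?I c + \<delta>)"
    using eventually_gt_at_top[of 0]
    by eventually_elim (simp add: field_simps add_diff_eq)
  have "\<forall>\<^sub>F m in sequentially. ?I c - \<delta> < (\<Sum>i=1..m. 1 / (x m i + (c + s))) / m"
    using tendsto_empirical_resolvent[OF assms(1) fin conv ge, of "c + s"] I(2) s c
    by (intro order_tendstoD) auto
  then have 2: "\<forall>\<^sub>F m in sequentially. m * (?I c - \<delta>) \<le> (\<Sum>i=1..m. 1 / (x m i + c + s))"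
    using eventually_gt_at_top[of 0]
    by eventually_elim (simp add: field_simps add.assoc)
  show ?thesis using that s 1 2 by blast
qed

section \<open>Inverting the passage time\<close>

text \<open>Linear growth of the passage time inverts to linear growth of the height, although the passage
  times to different endpoints need not be monotone in \<open>m\<close>: the columns before \<open>M\<close>, where nothing is
  known, lie below \<open>t / u\<close> and so cannot raise the supremum above \<open>t / l\<close>. The additional \<open>2\<close> in the
  threshold makes the witness $\lfloor t/u \rfloor$ a column beyond \<open>M\<close>.\<close>

lemma lpp_height_bounds:
  assumes linear: "\<And>m. M \<le> m \<Longrightarrow> 1 \<le> m \<Longrightarrow>
      real m * l \<le> last_passage (w m n) m n \<and> last_passage (w m n) m n \<le> real m * u"
    and "0 < l" "l \<le> u" and t: "(real M + 2) * u \<le> t"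
  shows "\<exists>h. lpp_height w n t = ereal h \<and> t / u - 1 \<le> h \<and> h \<le> t / l"
proof -
  let ?S = "{ereal (real m) | m. 1 \<le> m \<and> last_passage (w m n) m n \<le> t}"
  have "0 < u" using assms by linarith
  define k where "k = nat \<lfloor>t / u\<rfloor>"
  have tu: "real M + 2 \<le> t / u" using t \<open>0 < u\<close> by (simp add: field_simps)
  then have k: "real k \<le> t / u" "t / u - 1 \<le> real k" "M \<le> k" "1 \<le> k"
    unfolding k_def by linarith+
  have "last_passage (w k n) k n \<le> real k * u" using linear k by blast
  also have "\<dots> \<le> t" using k(1) \<open>0 < u\<close> by (simp add: field_simps)
  finally have "ereal (real k) \<in> ?S" using k by blast
  then have lower: "ereal (real k) \<le> Sup ?S" by (rule Sup_upper)
  have tl: "t / u \<le> t / l"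
  proof (intro divide_left_mono)
    show "0 \<le> t" using tu \<open>0 < u\<close> by (smt (verit) divide_nonpos_pos of_nat_0_le_iff)
  qed (use assms(2,3) in auto)
  have "Sup ?S \<le> ereal (t / l)"
  proof (rule Sup_least, clarsimp)
    fix m assume m: "Suc 0 \<le> m" "last_passage (w m n) m n \<le> t"
    show "real m \<le> t / l"
    proof (cases "M \<le> m")
      case True
      then have "real m * l \<le> t" using linear[of m] m by auto
      then show ?thesis using \<open>0 < l\<close> by (simp add: field_simps)
    next
      case False
      then show ?thesis using tu tl by linarith
    qed
  qed
  with lower obtain h where h: "Sup ?S = ereal h" by (cases "Sup ?S") auto
  with lower \<open>Sup ?S \<le> ereal (t / l)\<close> have "real k \<le> h" "h \<le> t / l" by auto
  then have "lpp_height w n t = ereal h" "t / u - 1 \<le> h"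
    using h k by (auto simp: lpp_height_def max_def)
  with \<open>h \<le> t / l\<close> show ?thesis by blast
qed

text \<open>The relative errors of $t/(A \pm \delta)$ are at most $2\delta/A^2 \le \epsilon/4$ times \<open>t\<close>. The
  rest of the budget \<open>\<epsilon> * t\<close>, at least \<open>3\<close> once $4/\epsilon \le t$, pays for rounding down to a column and
  for the constant by which the flux differs from the height.\<close>

lemma lpp_height_flux_close:
  assumes linear: "\<And>m. M \<le> m \<Longrightarrow> 1 \<le> m \<Longrightarrow>
      real m * (A - \<delta>) \<le> last_passage (w m n) m n \<and> last_passage (w m n) m n \<le> real m * (A + \<delta>)"
    and A: "0 < A" and \<delta>: "0 < \<delta>" "\<delta> \<le> A / 2" "\<delta> \<le> \<epsilon> * A\<^sup>2 / 8"
    and t: "(real M + 2) * (A + \<delta>) \<le> t" "4 / \<epsilon> \<le> t" and "0 < \<epsilon>"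
  shows "\<bar>lpp_height w n t - ereal (t / A)\<bar> \<le> ereal (\<epsilon> * t)"
    and "\<bar>lpp_flux w n t - ereal (t / A) + ereal (real n)\<bar> \<le> ereal (\<epsilon> * t)"
proof -
  have "0 < A - \<delta>" "A - \<delta> \<le> A + \<delta>" using A \<delta> by auto
  then obtain h where h: "lpp_height w n t = ereal h" "t / (A + \<delta>) - 1 \<le> h" "h \<le> t / (A - \<delta>)"
    using lpp_height_bounds[where w = w and n = n and M = M and l = "A - \<delta>" and u = "A + \<delta>" and t = t]
      linear t(1) by blast
  have "0 < t" using t(2) \<open>0 < \<epsilon>\<close> by (smt (verit) divide_pos_pos)
  have \<epsilon>t: "4 \<le> \<epsilon> * t" using t(2) \<open>0 < \<epsilon>\<close> by (simp add: field_simps)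
  have A2: "A\<^sup>2 / 2 \<le> A * (A - \<delta>)" "A\<^sup>2 / 2 \<le> A * (A + \<delta>)"
  proof -
    have "A * \<delta> \<le> A * (A / 2)" using A \<delta>(2) by (intro mult_left_mono) auto
    moreover have "0 \<le> A * \<delta>" "0 \<le> A * A" using A \<delta>(1) by auto
    ultimately show "A\<^sup>2 / 2 \<le> A * (A - \<delta>)" "A\<^sup>2 / 2 \<le> A * (A + \<delta>)"
      unfolding power2_eq_square right_diff_distrib distrib_left times_divide_eq_right
      by linarith+
  qed
  have half: "t * \<delta> / (A\<^sup>2 / 2) \<le> \<epsilon> * t / 4"
    using mult_left_mono[OF \<delta>(3), of t] A \<open>0 < t\<close> by (simp add: field_simps)
  have "t / (A - \<delta>) - t / A = t * \<delta> / (A * (A - \<delta>))"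
    using A \<open>0 < A - \<delta>\<close> by (simp add: field_simps)
  also have "\<dots> \<le> t * \<delta> / (A\<^sup>2 / 2)"
    using A2 A \<delta> \<open>0 < t\<close> by (intro divide_left_mono) auto
  finally have up: "h - t / A \<le> \<epsilon> * t / 4" using h half by linarith
  have "t / A - t / (A + \<delta>) = t * \<delta> / (A * (A + \<delta>))"
    using A \<delta> by (simp add: field_simps)
  also have "\<dots> \<le> t * \<delta> / (A\<^sup>2 / 2)"
    using A2 A \<delta> \<open>0 < t\<close> by (intro divide_left_mono) auto
  finally have "t / A - h \<le> \<epsilon> * t / 4 + 1" using h half by linarith
  with up \<epsilon>t have "\<bar>h - t / A\<bar> \<le> \<epsilon> * t" "\<bar>h - t / A + 1\<bar> \<le> \<epsilon> * t" by linarith+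
  then show "\<bar>lpp_height w n t - ereal (t / A)\<bar> \<le> ereal (\<epsilon> * t)"
    and "\<bar>lpp_flux w n t - ereal (t / A) + ereal (real n)\<bar> \<le> ereal (\<epsilon> * t)"
    using h(1) by (simp_all add: lpp_flux_def one_ereal_def algebra_simps)
qed

section \<open>Tails of the passage time\<close>

lemma up_right_paths_nonempty: "1 \<le> m \<Longrightarrow> 1 \<le> n \<Longrightarrow> {p. up_right_path m n p} \<noteq> {}"
  using up_right_path_through_row[of m 1 n] by auto

lemma path_sum_le_last_passage: "up_right_path m n p \<Longrightarrow> (\<Sum>(i, j)\<leftarrow>p. W i j) \<le> last_passage W m n"
  unfolding last_passage_def by (intro Max_ge) (auto simp: finite_up_right_paths)

lemma last_passage_attained:
  assumes "1 \<le> m" "1 \<le> n"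
  obtains p where "up_right_path m n p" "last_passage W m n = (\<Sum>(i, j)\<leftarrow>p. W i j)"
proof -
  have "last_passage W m n \<in> (\<lambda>p. \<Sum>(i, j)\<leftarrow>p. W i j) ` {p. up_right_path m n p}"
    unfolding last_passage_def
    by (intro Max_in) (use up_right_paths_nonempty[OF assms] in \<open>auto simp: finite_up_right_paths\<close>)
  then show ?thesis using that by auto
qed

lemma path_sum_conv_sum_set:
  "up_right_path m n p \<Longrightarrow> (\<Sum>(i, j)\<leftarrow>p. W i j :: real) = (\<Sum>c\<in>set p. (\<lambda>(i, j). W i j) c)"
  by (simp add: sum_list_distinct_conv_sum_set up_right_path_distinct)

lemma borel_measurable_path_sum:
  assumes "up_right_path m n p"
    and W: "\<And>i j. i \<in> {1..m} \<Longrightarrow> j \<in> {1..n} \<Longrightarrow> W i j \<in> borel_measurable M"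
  shows "(\<lambda>x. \<Sum>(i, j)\<leftarrow>p. W i j x :: real) \<in> borel_measurable M"
proof -
  have "(\<lambda>x. \<Sum>c\<in>set p. (\<lambda>(i, j). W i j x) c) \<in> borel_measurable M"
  proof (rule borel_measurable_sum)
    fix c assume "c \<in> set p"
    then show "(\<lambda>x. case c of (i, j) \<Rightarrow> W i j x) \<in> borel_measurable M"
      using up_right_path_subset[OF assms(1)] W by (cases c) auto
  qed
  then show ?thesis by (simp add: path_sum_conv_sum_set[OF assms(1)])
qed

lemma borel_measurable_last_passage:
  assumes "\<And>i j. i \<in> {1..m} \<Longrightarrow> j \<in> {1..n} \<Longrightarrow> W i j \<in> borel_measurable M"
  shows "(\<lambda>x. last_passage (\<lambda>i j. W i j x) m n) \<in> borel_measurable M"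
  unfolding last_passage_def
  by (rule borel_measurable_Max) (auto simp: finite_up_right_paths intro!: borel_measurable_path_sum assms)

text \<open>For the upper tail the rates in the column \<open>i\<close> are all replaced by a common lower bound \<open>L i\<close>;
  the repeated visits to a column cost a constant factor that does not grow with \<open>m\<close>.\<close>

lemma (in prob_space) path_sum_upper_tail:
  assumes path: "up_right_path m n p"
    and indep: "indep_vars (\<lambda>_. borel) (\<lambda>(i, j). W i j) ({1..m} \<times> {1..n})"
    and distr: "\<And>i j. i \<in> {1..m} \<Longrightarrow> j \<in> {1..n} \<Longrightarrow>
      distributed M lborel (W i j) (exponential_density (r i j))"
    and rate: "\<And>i j. i \<in> {1..m} \<Longrightarrow> j \<in> {1..n} \<Longrightarrow> \<kappa> \<le> L i \<and> L i \<le> r i j"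
    and s: "0 < s" "s < \<kappa>"
  shows "prob {x \<in> space M. u \<le> (\<Sum>(i, j)\<leftarrow>p. W i j x)} \<le>
    exp (- s * u + s * (\<Sum>i=1..m. 1 / (L i - s)) + real (n - 1) * (s / (\<kappa> - s)))"
proof -
  note sub = up_right_path_subset[OF path]
  have rate': "\<kappa> \<le> L (fst c)" "L (fst c) \<le> (\<lambda>(i, j). r i j) c" if "c \<in> set p" for c
    using sub rate that by (cases c; force)+
  have "prob {x \<in> space M. s * u \<le> s * (\<Sum>c\<in>set p. (\<lambda>(i, j). W i j) c x)} \<le>
      exp (- s * u + (\<Sum>c\<in>set p. s / ((\<lambda>(i, j). r i j) c - s)))"
  proof (rule chernoff_exponential_sum)
    show "indep_vars (\<lambda>_. borel) (\<lambda>(i, j). W i j) (set p)"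
      using indep sub by (blast intro: indep_vars_subset)
    show "distributed M lborel ((\<lambda>(i, j). W i j) c) (exponential_density ((\<lambda>(i, j). r i j) c))"
      if "c \<in> set p" for c
      using sub distr that by (cases c) auto
  qed (use rate' s in fastforce)+
  also have "{x \<in> space M. s * u \<le> s * (\<Sum>c\<in>set p. (\<lambda>(i, j). W i j) c x)} =
      {x \<in> space M. u \<le> (\<Sum>(i, j)\<leftarrow>p. W i j x)}"
    using s by (auto simp: path_sum_conv_sum_set[OF path] case_prod_beta)
  also have "(\<Sum>c\<in>set p. s / ((\<lambda>(i, j). r i j) c - s)) \<le> (\<Sum>c\<in>set p. s / (L (fst c) - s))"
    using rate' s by (intro sum_mono divide_left_mono mult_pos_pos) (auto, (smt (verit))+)
  also have "\<dots> = (\<Sum>(i, j)\<leftarrow>p. s / (L i - s))"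
    by (simp add: path_sum_conv_sum_set[OF path] case_prod_beta)
  also have "\<dots> \<le> (\<Sum>i=1..m. s / (L i - s)) + real (n - 1) * (s / (\<kappa> - s))"
  proof (rule up_right_path_column_sum_le[OF path])
    fix i assume "i \<in> {1..m}"
    then have "\<kappa> \<le> L i" using rate[of i 1] sub by auto
    then show "s / (L i - s) \<le> s / (\<kappa> - s)" using s by (intro divide_left_mono) auto
  qed
  finally show ?thesis by (simp add: sum_distrib_left add.assoc add.commute add_diff_eq)
qed

text \<open>For the lower tail all cells off one row can be ignored: each contributes a factor
  $\mathbf E e^{-sX} \le 1$.\<close>

lemma (in prob_space) path_sum_lower_tail:
  assumes path: "up_right_path m n p" "{1..m} \<times> {k} \<subseteq> set p"
    and indep: "indep_vars (\<lambda>_. borel) (\<lambda>(i, j). W i j) ({1..m} \<times> {1..n})"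
    and distr: "\<And>i j. i \<in> {1..m} \<Longrightarrow> j \<in> {1..n} \<Longrightarrow>
      distributed M lborel (W i j) (exponential_density (r i j))"
    and rate: "\<And>i j. i \<in> {1..m} \<Longrightarrow> j \<in> {1..n} \<Longrightarrow> 0 < r i j"
    and s: "0 < s"
  shows "prob {x \<in> space M. (\<Sum>(i, j)\<leftarrow>p. W i j x) \<le> u} \<le> exp (s * u - s * (\<Sum>i=1..m. 1 / (r i k + s)))"
proof -
  note sub = up_right_path_subset[OF path(1)]
  have rate': "0 < (\<lambda>(i, j). r i j) c" if "c \<in> set p" for c
    using sub rate that by (cases c) auto
  have "prob {x \<in> space M. - s * u \<le> - s * (\<Sum>c\<in>set p. (\<lambda>(i, j). W i j) c x)} \<le>
      exp (- (- s) * u + (\<Sum>c\<in>set p. - s / ((\<lambda>(i, j). r i j) c - - s)))"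
  proof (rule chernoff_exponential_sum)
    show "indep_vars (\<lambda>_. borel) (\<lambda>(i, j). W i j) (set p)"
      using indep sub by (blast intro: indep_vars_subset)
    show "distributed M lborel ((\<lambda>(i, j). W i j) c) (exponential_density ((\<lambda>(i, j). r i j) c))"
      if "c \<in> set p" for c
      using sub distr that by (cases c) auto
  qed (use rate' s in fastforce)+
  also have "{x \<in> space M. - s * u \<le> - s * (\<Sum>c\<in>set p. (\<lambda>(i, j). W i j) c x)} =
      {x \<in> space M. (\<Sum>(i, j)\<leftarrow>p. W i j x) \<le> u}"
    using s by (auto simp: path_sum_conv_sum_set[OF path(1)] case_prod_beta)
  also have "(\<Sum>c\<in>set p. - s / ((\<lambda>(i, j). r i j) c - - s)) = - (\<Sum>c\<in>set p. s / ((\<lambda>(i, j). r i j) c + s))"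
    by (simp add: sum_negf)
  also have "\<dots> \<le> - (\<Sum>c\<in>{1..m} \<times> {k}. s / ((\<lambda>(i, j). r i j) c + s))"
    using rate' s path(2) by (auto intro!: sum_mono2 simp: less_imp_le)
  also have "(\<Sum>c\<in>{1..m} \<times> {k}. s / ((\<lambda>(i, j). r i j) c + s)) = (\<Sum>(i, j)\<in>{1..m} \<times> {k}. s / (r i j + s))"
    by (simp add: case_prod_beta)
  also have "\<dots> = s * (\<Sum>i=1..m. 1 / (r i k + s))"
    by (simp only: sum.cartesian_product[symmetric]) (simp add: sum_distrib_left)
  finally show ?thesis by simp
qed

lemma summable_power_times_exp:
  fixes c :: real
  assumes "0 < c"
  shows "summable (\<lambda>m. real m ^ k * exp (- c * real m))"
proof (rule summable_comparison_test_ev)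
  have "((\<lambda>x::real. x ^ (k + 2) / exp x) \<longlongrightarrow> 0) at_top" by (rule tendsto_power_div_exp_0)
  moreover have "filterlim (\<lambda>m. c * real m) at_top sequentially"
    using assms by real_asymp
  ultimately have "(\<lambda>m. (c * real m) ^ (k + 2) / exp (c * real m)) \<longlonglongrightarrow> 0"
    by (rule filterlim_compose)
  then have "\<forall>\<^sub>F m in sequentially. (c * real m) ^ (k + 2) / exp (c * real m) < 1"
    by (rule order_tendstoD) simp
  then show "\<forall>\<^sub>F m in sequentially. norm (real m ^ k * exp (- c * real m)) \<le> 1 / c ^ (k + 2) * (1 / real m ^ 2)"
    using eventually_gt_at_top[of 0]
  proof eventually_elim
    case (elim m)
    then have "c ^ (k + 2) * real m ^ 2 * (real m ^ k * exp (- c * real m)) \<le> 1"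
      by (simp add: power_mult_distrib power_add exp_minus field_simps power2_eq_square)
    then show ?case
      using assms elim by (simp add: field_simps power2_eq_square)
  qed
  show "summable (\<lambda>m. 1 / c ^ (k + 2) * (1 / real m ^ 2))"
    by (intro summable_mult) (use inverse_power_summable[of 2, where 'a = real] in \<open>simp add: field_simps\<close>)
qed

text \<open>The law of large numbers behind the theorem. Deviations by \<open>2 \<delta> m\<close> from $m A$ have a Chernoff
  exponent at most \<open>- s \<delta> m\<close> up to a constant, and the union over the at most \<open>m ^ n\<close> paths leaves a summable bound.\<close>

lemma (in prob_space) AE_last_passage_linear:
  fixes W :: "nat \<Rightarrow> nat \<Rightarrow> nat \<Rightarrow> 'a \<Rightarrow> real" and a :: "nat \<Rightarrow> nat \<Rightarrow> real" and b :: "nat \<Rightarrow> real"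
  assumes indep: "\<And>m. 1 \<le> m \<Longrightarrow> indep_vars (\<lambda>_. borel) (\<lambda>(i, j). W m i j) ({1..m} \<times> {1..n})"
    and distr: "\<And>m i j. i \<in> {1..m} \<Longrightarrow> j \<in> {1..n} \<Longrightarrow>
      distributed M lborel (W m i j) (exponential_density (a m i + b j))"
    and k: "k \<in> {1..n}" "\<And>j. j \<in> {1..n} \<Longrightarrow> b k \<le> b j"
    and ge: "\<forall>\<^sub>F m in sequentially. \<forall>i\<in>{1..m}. d \<le> a m i" and d: "0 < d + b k"
    and alpha: "sets \<alpha> = sets borel" "subprob_space \<alpha>" "vague_conv (\<lambda>m. empirical (a m) m) \<alpha>"
    and A: "A = (\<integral>y. 1 / (y + b k) \<partial>\<alpha>)" and "0 < \<delta>"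
  shows "AE x in M. \<forall>\<^sub>F m in sequentially.
    real m * (A - 2 * \<delta>) \<le> last_passage (\<lambda>i j. W m i j x) m n \<and>
    last_passage (\<lambda>i j. W m i j x) m n \<le> real m * (A + 2 * \<delta>)"
proof -
  define \<kappa> where "\<kappa> = d + b k"
  obtain s where s: "0 < s" "s \<le> \<kappa> / 2"
    and up: "\<forall>\<^sub>F m in sequentially. (\<Sum>i=1..m. 1 / (a m i + b k - s)) \<le> m * (A + \<delta>)"
    and lo: "\<forall>\<^sub>F m in sequentially. m * (A - \<delta>) \<le> (\<Sum>i=1..m. 1 / (a m i + b k + s))"
    using eventually_shifted_resolvent_sums[OF alpha ge d \<open>0 < \<delta>\<close>] unfolding A \<kappa>_def by blast
  define G where "G m x = last_passage (\<lambda>i j. W m i j x) m n" for m x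
  have [measurable]: "G m \<in> borel_measurable M" for m
    unfolding G_def using distributed_measurable[OF distr]
    by (intro borel_measurable_last_passage) simp
  define bad where "bad m = {x \<in> space M. 1 \<le> m \<and>
      \<not> (real m * (A - 2 * \<delta>) \<le> G m x \<and> G m x \<le> real m * (A + 2 * \<delta>))}" for m
  have [measurable]: "bad m \<in> sets M" for m unfolding bad_def by simp
  define K where "K = exp (real (n - 1) * (s / (\<kappa> - s)))"
  have "\<forall>\<^sub>F m in sequentially. norm (prob (bad m)) \<le>
      K * (real m ^ n * exp (- (s * \<delta>) * real m)) + real m ^ 0 * exp (- (s * \<delta>) * real m)"
    using ge up lo eventually_ge_at_top[of 1]
  proof eventually_elim
    case (elim m)
    let ?S = "\<lambda>p x. \<Sum>(i, j)\<leftarrow>p. W m i j x"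
    have [measurable]: "?S p \<in> borel_measurable M" if "up_right_path m n p" for p
      using distributed_measurable[OF distr] that by (intro borel_measurable_path_sum) auto
    let ?U = "\<lambda>p. {x \<in> space M. real m * (A + 2 * \<delta>) \<le> ?S p x}"
    let ?paths = "{p. up_right_path m n p}"
    obtain q where q: "up_right_path m n q" "{1..m} \<times> {k} \<subseteq> set q"
      using up_right_path_through_row[of m k n] elim(4) k(1) by blast
    let ?L = "{x \<in> space M. ?S q x \<le> real m * (A - 2 * \<delta>)}"
    have rate: "\<kappa> \<le> a m i + b k \<and> a m i + b k \<le> a m i + b j" if "i \<in> {1..m}" "j \<in> {1..n}" for i j
      using elim(1) k(2) that unfolding \<kappa>_def by auto
    have \<kappa>: "0 < \<kappa>" "s < \<kappa>" using d s unfolding \<kappa>_def by auto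
    have U: "prob (?U p) \<le> K * exp (- (s * \<delta>) * real m)" if "p \<in> ?paths" for p
    proof -
      have "prob (?U p) \<le> exp (- s * (real m * (A + 2 * \<delta>)) +
          s * (\<Sum>i=1..m. 1 / (a m i + b k - s)) + real (n - 1) * (s / (\<kappa> - s)))"
        using that elim(4) s(1) \<kappa> rate distr
        by (intro path_sum_upper_tail[where r = "\<lambda>i j. a m i + b j"] indep) auto
      also have "\<dots> \<le> exp (real (n - 1) * (s / (\<kappa> - s)) + - (s * \<delta>) * real m)"
        using mult_left_mono[OF elim(2), of s] s(1) by (simp add: algebra_simps)
      finally show ?thesis unfolding K_def exp_add .
    qed
    have "prob ?L \<le> exp (s * (real m * (A - 2 * \<delta>)) - s * (\<Sum>i=1..m. 1 / (a m i + b k + s)))"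
    proof (rule path_sum_lower_tail[OF q])
      show "0 < a m i + b j" if "i \<in> {1..m}" "j \<in> {1..n}" for i j
        using rate[OF that] \<kappa> by linarith
    qed (use elim(4) s(1) distr indep in auto)
    also have "\<dots> \<le> exp (- (s * \<delta>) * real m)"
      using mult_left_mono[OF elim(3), of s] s(1) by (simp add: algebra_simps)
    finally have L: "prob ?L \<le> exp (- (s * \<delta>) * real m)" .
    have "bad m \<subseteq> (\<Union>p\<in>?paths. ?U p) \<union> ?L"
    proof
      fix x assume x: "x \<in> bad m"
      obtain p where p: "up_right_path m n p" "G m x = ?S p x"
        unfolding G_def using elim(4) k(1)
      by (auto intro: last_passage_attained[of m n "\<lambda>i j. W m i j x"])
      have "?S q x \<le> G m x" unfolding G_def by (rule path_sum_le_last_passage[OF q(1)])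
      with x p show "x \<in> (\<Union>p\<in>?paths. ?U p) \<union> ?L" by (auto simp: bad_def)
    qed
    then have "prob (bad m) \<le> prob ((\<Union>p\<in>?paths. ?U p) \<union> ?L)"
      using q(1) by (intro finite_measure_mono) (auto intro!: sets.Un sets.finite_UN simp: finite_up_right_paths)
    also have "\<dots> \<le> prob (\<Union>p\<in>?paths. ?U p) + prob ?L"
      using q(1) by (intro measure_Un_le) (auto intro!: sets.finite_UN simp: finite_up_right_paths)
    also have "prob (\<Union>p\<in>?paths. ?U p) \<le> (\<Sum>p\<in>?paths. prob (?U p))"
      by (intro measure_UNION_le) (auto simp: finite_up_right_paths)
    also have "\<dots> \<le> real (card ?paths) * (K * exp (- (s * \<delta>) * real m))"
      by (rule sum_bounded_above[OF U])
    also have "\<dots> \<le> real m ^ n * (K * exp (- (s * \<delta>) * real m))"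
      using card_up_right_paths_le[of m n] unfolding K_def
      by (intro mult_right_mono) (auto simp flip: of_nat_power)
    finally show ?case using L by (simp add: mult_ac)
  qed
  moreover have "summable (\<lambda>m. K * (real m ^ n * exp (- (s * \<delta>) * real m)) +
      real m ^ 0 * exp (- (s * \<delta>) * real m))"
    using s(1) \<open>0 < \<delta>\<close> by (intro summable_add summable_mult summable_power_times_exp) auto
  ultimately have "summable (\<lambda>m. prob (bad m))"
    by (rule summable_comparison_test_ev)
  then have "AE x in M. \<forall>\<^sub>F m in sequentially. x \<in> space M - bad m"
    by (intro borel_cantelli_AE1) (auto simp: less_top[symmetric])
  then show ?thesis
  proof eventually_elim
    case (elim x)
    then show ?case
      using eventually_ge_at_top[of 1]
      by eventually_elim (auto simp: bad_def G_def)
  qed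
qed

section \<open>Linear growth of the height\<close>

theorem theorem3p11:
  fixes a b :: "nat \<Rightarrow> nat \<Rightarrow> real"
    and \<omega> :: "nat \<Rightarrow> nat \<Rightarrow> nat \<Rightarrow> nat \<Rightarrow> (nat \<times> nat \<Rightarrow> real) \<Rightarrow> real"
    and \<alpha> :: "real measure" and \<aa> :: ereal
    and n :: nat and \<epsilon> A :: real
  assumes pos: "\<And>m n i j. 1 \<le> m \<Longrightarrow> 1 \<le> n \<Longrightarrow> i \<in> {1..m} \<Longrightarrow> j \<in> {1..n} \<Longrightarrow> a m i + b n j > 0"
    and indep: "\<And>m n. 1 \<le> m \<Longrightarrow> 1 \<le> n \<Longrightarrow>
      prob_space.indep_vars exp_space (\<lambda>_. borel) (\<lambda>(i, j). \<omega> m n i j) ({1..m} \<times> {1..n})"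
    and distr: "\<And>m n i j. 1 \<le> m \<Longrightarrow> 1 \<le> n \<Longrightarrow> i \<in> {1..m} \<Longrightarrow> j \<in> {1..n} \<Longrightarrow>
      distributed exp_space lborel (\<omega> m n i j) (exponential_density (a m i + b n j))"
    and "sets \<alpha> = sets borel" and "subprob_space \<alpha>" and "emeasure \<alpha> UNIV \<noteq> 0"
    and "vague_conv (\<lambda>m. empirical (a m) m) \<alpha>"
    and "\<aa> \<noteq> -\<infinity>" and "(\<lambda>m. ereal (Min (a m ` {1..m}))) \<longlonglongrightarrow> \<aa>"
    and "1 \<le> n" and "\<aa> + ereal (Min (b n ` {1..n})) > 0"
    and "\<epsilon> > 0"
    and "A = (\<integral>x. 1 / (x + Min (b n ` {1..n})) \<partial>\<alpha>)"
  shows "\<exists>T \<in> exp_space \<rightarrow>\<^sub>M count_space (UNIV :: nat set). (\<forall>x \<in> space exp_space. T x > 0) \<and>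
    (AE x in exp_space. \<forall>t::real. t \<ge> real (T x) \<longrightarrow>
       \<bar>lpp_height (\<lambda>m n i j. \<omega> m n i j x) n t - ereal (t / A)\<bar> \<le> ereal (\<epsilon> * t) \<and>
       \<bar>lpp_flux (\<lambda>m n i j. \<omega> m n i j x) n t - ereal (t / A) + ereal (real n)\<bar> \<le> ereal (\<epsilon> * t))"
proof -
  interpret prob_space exp_space by (rule prob_space_exp_space)
  have "Min (b n ` {1..n}) \<in> b n ` {1..n}" using \<open>1 \<le> n\<close> by (intro Min_in) auto
  then obtain k where k: "k \<in> {1..n}" "Min (b n ` {1..n}) = b n k" by auto
  have k_min: "b n k \<le> b n j" if "j \<in> {1..n}" for j
    unfolding k(2)[symmetric] using that by (intro Min_le) auto
  have "ereal (- b n k) < \<aa>"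
    using assms(11) unfolding k(2) by (cases \<aa>) auto
  then obtain d where d: "- b n k < d" "ereal d < \<aa>"
    using ereal_dense2 by (metis less_ereal.simps(1))
  have ge: "\<forall>\<^sub>F m in sequentially. \<forall>i\<in>{1..m}. d \<le> a m i"
    using order_tendstoD(1)[OF assms(9) d(2)]
  proof eventually_elim
    case (elim m)
    show ?case
    proof
      fix i assume "i \<in> {1..m}"
      then have "Min (a m ` {1..m}) \<le> a m i" by (intro Min_le) auto
      with elim show "d \<le> a m i" by simp
    qed
  qed
  have dk: "0 < d + b n k" using d(1) by linarith
  have A: "A = (\<integral>y. 1 / (y + b n k) \<partial>\<alpha>)" using assms(13) k(2) by simp
  have fin: "finite_measure \<alpha>" using assms(5) by (rule subprob_space.axioms)
  have "0 < A"
    unfolding A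
    by (rule resolvent_integral_pos[OF assms(4) fin assms(6) AE_vague_limit_ge[OF assms(4) fin assms(7) ge] dk])
  define \<delta> where "\<delta> = min (A / 2) (\<epsilon> * A\<^sup>2 / 8)"
  have \<delta>: "0 < \<delta>" "\<delta> \<le> A / 2" "\<delta> \<le> \<epsilon> * A\<^sup>2 / 8"
    using \<open>0 < A\<close> \<open>0 < \<epsilon>\<close> by (auto simp: \<delta>_def)
  define good where "good m x \<longleftrightarrow> real m * (A - \<delta>) \<le> last_passage (\<lambda>i j. \<omega> m n i j x) m n \<and>
      last_passage (\<lambda>i j. \<omega> m n i j x) m n \<le> real m * (A + \<delta>)" for m x
  have [measurable]: "(\<lambda>x. last_passage (\<lambda>i j. \<omega> m n i j x) m n) \<in> borel_measurable exp_space" for m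
    using distributed_measurable[OF distr] \<open>1 \<le> n\<close>
    by (intro borel_measurable_last_passage) simp
  have [measurable]: "Measurable.pred exp_space (good m)" for m
    unfolding good_def by measurable
  have AE_good: "AE x in exp_space. \<exists>M. \<forall>m\<ge>M. good m x"
    using AE_last_passage_linear[where W = "\<lambda>m. \<omega> m n" and a = a and b = "b n" and n = n and \<delta> = "\<delta> / 2",
        OF indep distr k(1) k_min ge dk assms(4,5,7) A] \<open>1 \<le> n\<close> \<delta>(1)
    by (simp add: good_def eventually_sequentially)
  define N where "N x = (LEAST M. \<forall>m\<ge>M. good m x)" for x
  have [measurable]: "N \<in> exp_space \<rightarrow>\<^sub>M count_space UNIV"
    unfolding N_def by measurable
  \<comment> \<open>The onset \<open>N\<close> of linear growth is the only random ingredient of the threshold; multiplying by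
    \<open>C\<close> places \<open>t\<close> beyond the passage time to column \<open>N + 2\<close> and makes \<open>\<epsilon> * t\<close> absorb rounding.\<close>
  define C where "C = nat \<lceil>max (A + \<delta>) (4 / \<epsilon>)\<rceil>"
  have C: "A + \<delta> \<le> real C" "4 / \<epsilon> \<le> real C" unfolding C_def by linarith+
  then have "0 < C" using \<open>0 < A\<close> \<delta>(1) by (cases C) auto
  show ?thesis
  proof (intro bexI[of _ "\<lambda>x. (N x + 2) * C"] conjI)
    show "AE x in exp_space. \<forall>t::real. t \<ge> real ((N x + 2) * C) \<longrightarrow>
       \<bar>lpp_height (\<lambda>m n i j. \<omega> m n i j x) n t - ereal (t / A)\<bar> \<le> ereal (\<epsilon> * t) \<and>
       \<bar>lpp_flux (\<lambda>m n i j. \<omega> m n i j x) n t - ereal (t / A) + ereal (real n)\<bar> \<le> ereal (\<epsilon> * t)"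
      using AE_good
    proof eventually_elim
      case (elim x)
      then have N: "\<forall>m\<ge>N x. good m x" unfolding N_def by (rule LeastI_ex)
      show ?case
      proof (intro allI impI)
        fix t :: real assume t: "real ((N x + 2) * C) \<le> t"
        have NC: "real ((N x + 2) * C) = (real (N x) + 2) * real C"
          by (simp only: of_nat_mult of_nat_add of_nat_numeral)
        have "(real (N x) + 2) * (A + \<delta>) \<le> (real (N x) + 2) * real C"
          using C by (intro mult_left_mono) auto
        then have t1: "(real (N x) + 2) * (A + \<delta>) \<le> t" using t unfolding NC by linarith
        have "1 * real C \<le> (real (N x) + 2) * real C" by (intro mult_right_mono) auto
        then have t2: "4 / \<epsilon> \<le> t" using t C(2) unfolding NC by linarith
        have lin: "real m * (A - \<delta>) \<le> last_passage (\<lambda>i j. \<omega> m n i j x) m n \<and>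
            last_passage (\<lambda>i j. \<omega> m n i j x) m n \<le> real m * (A + \<delta>)" if "N x \<le> m" for m
          using N that unfolding good_def by blast
        show "\<bar>lpp_height (\<lambda>m n i j. \<omega> m n i j x) n t - ereal (t / A)\<bar> \<le> ereal (\<epsilon> * t) \<and>
            \<bar>lpp_flux (\<lambda>m n i j. \<omega> m n i j x) n t - ereal (t / A) + ereal (real n)\<bar> \<le> ereal (\<epsilon> * t)"
          using lpp_height_flux_close[where w = "\<lambda>m n i j. \<omega> m n i j x" and n = n and M = "N x",
              OF _ \<open>0 < A\<close> \<delta> t1 t2 \<open>0 < \<epsilon>\<close>] lin by blast
      qed
    qed
  qed (use \<open>0 < C\<close> in auto)
qed

end
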